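(* Let $2<p,q<\infty$. There is no linear isometric embedding (norm-preserving complex-linear map) of the complex Banach space $(\mathbb{C}^2,\|\cdot\|_{B_{p,q}})$ into $S_\infty$, the space of all compact operators on $\ell_2$.
   Context: $B_{p,q}:=\{(z_1,z_2)\in\mathbb{C}^2:|z_1|^p+|z_2|^q<1\}$, and $\|\cdot\|_{B_{p,q}}$ is the norm on $\mathbb{C}^2$ whose open unit ball is $B_{p,q}$ (its Minkowski functional). $\ell_2$ is the complex Hilbert space of square-summable sequences, and $S_\infty$ carries the operator norm of $B(\ell_2)$. *)

theory Defs
  imports "HOL-Analysis.Analysis"
begin

section \<open>The space of complex square-summable sequences\<close>

typedef ell2 = "{x :: nat \<Rightarrow> complex. summable (\<lambda>n. (cmod (x n))\<^sup>2)}"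
  morphisms ell2_nth Abs_ell2
  by (rule exI[of _ "\<lambda>_. 0"]) simp

setup_lifting type_definition_ell2

lemma square_summable_add:
  fixes x y :: "nat \<Rightarrow> complex"
  assumes "summable (\<lambda>n. (cmod (x n))\<^sup>2)" "summable (\<lambda>n. (cmod (y n))\<^sup>2)"
  shows "summable (\<lambda>n. (cmod (x n + y n))\<^sup>2)"
proof (rule summable_comparison_test')
  show "summable (\<lambda>n. 2 * (cmod (x n))\<^sup>2 + 2 * (cmod (y n))\<^sup>2)"
    using assms by (intro summable_add summable_mult)
  fix n :: nat
  have "(cmod (x n + y n))\<^sup>2 \<le> (cmod (x n) + cmod (y n))\<^sup>2"
    by (intro power_mono norm_triangle_ineq) simp
  also have "\<dots> \<le> 2 * (cmod (x n))\<^sup>2 + 2 * (cmod (y n))\<^sup>2"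
    using sum_squares_bound[of "cmod (x n)" "cmod (y n)"] by (simp add: power2_sum)
  finally show "norm ((cmod (x n + y n))\<^sup>2) \<le> 2 * (cmod (x n))\<^sup>2 + 2 * (cmod (y n))\<^sup>2"
    by simp
qed

lemma square_summable_scale:
  fixes x :: "nat \<Rightarrow> complex"
  assumes "summable (\<lambda>n. (cmod (x n))\<^sup>2)"
  shows "summable (\<lambda>n. (cmod (c * x n))\<^sup>2)"
  using summable_mult[OF assms, of "(cmod c)\<^sup>2"] by (simp add: norm_mult power_mult_distrib)

lemma square_summable_inner:
  fixes x y :: "nat \<Rightarrow> complex"
  assumes "summable (\<lambda>n. (cmod (x n))\<^sup>2)" "summable (\<lambda>n. (cmod (y n))\<^sup>2)"
  shows "summable (\<lambda>n. inner (x n) (y n))"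
proof (rule summable_comparison_test')
  show "summable (\<lambda>n. (cmod (x n))\<^sup>2 + (cmod (y n))\<^sup>2)"
    using assms by (rule summable_add)
  fix n :: nat
  have "\<bar>inner (x n) (y n)\<bar> \<le> cmod (x n) * cmod (y n)"
    by (rule Cauchy_Schwarz_ineq2)
  also have "\<dots> \<le> (cmod (x n))\<^sup>2 + (cmod (y n))\<^sup>2"
    using sum_squares_bound[of "cmod (x n)" "cmod (y n)"]
      mult_nonneg_nonneg[of "cmod (x n)" "cmod (y n)"] by (simp del: mult_nonneg_nonneg)
  finally show "norm (inner (x n) (y n)) \<le> (cmod (x n))\<^sup>2 + (cmod (y n))\<^sup>2"
    by simp
qed

lift_definition scaleC_ell2 :: "complex \<Rightarrow> ell2 \<Rightarrow> ell2" is "\<lambda>c x n. c * x n"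
  by (rule square_summable_scale)

instantiation ell2 :: real_inner
begin

lift_definition zero_ell2 :: ell2 is "\<lambda>_. 0" by simp
lift_definition plus_ell2 :: "ell2 \<Rightarrow> ell2 \<Rightarrow> ell2" is "\<lambda>x y n. x n + y n"
  by (rule square_summable_add)
lift_definition uminus_ell2 :: "ell2 \<Rightarrow> ell2" is "\<lambda>x n. - x n" by simp
definition minus_ell2 :: "ell2 \<Rightarrow> ell2 \<Rightarrow> ell2" where "x - y = x + (- y)" for x y :: ell2
definition scaleR_ell2 :: "real \<Rightarrow> ell2 \<Rightarrow> ell2"
  where "scaleR_ell2 r x = scaleC_ell2 (complex_of_real r) x"

text \<open>The class \<^class>\<open>real_inner\<close> asks for the real part of the Hermitian inner product.\<close>

definition inner_ell2 :: "ell2 \<Rightarrow> ell2 \<Rightarrow> real"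
  where "inner_ell2 x y = (\<Sum>n. inner (ell2_nth x n) (ell2_nth y n))"
definition norm_ell2 :: "ell2 \<Rightarrow> real"
  where "norm_ell2 x = sqrt (\<Sum>n. (cmod (ell2_nth x n))\<^sup>2)"
definition sgn_ell2 :: "ell2 \<Rightarrow> ell2" where "sgn_ell2 x = inverse (norm x) *\<^sub>R x"
definition dist_ell2 :: "ell2 \<Rightarrow> ell2 \<Rightarrow> real" where "dist_ell2 x y = norm (x - y)"
definition uniformity_ell2 :: "(ell2 \<times> ell2) filter"
  where "uniformity_ell2 = (INF e\<in>{0<..}. principal {(x, y). dist x y < e})"
definition open_ell2 :: "ell2 set \<Rightarrow> bool"
  where "open_ell2 U \<longleftrightarrow> (\<forall>x\<in>U. \<forall>\<^sub>F (x', y) in uniformity. x' = x \<longrightarrow> y \<in> U)"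

instance
proof
  fix x y z :: ell2 and a b r :: real and U :: "ell2 set"
  have sq: "summable (\<lambda>n. (cmod (ell2_nth u n))\<^sup>2)" for u
    using ell2_nth[of u] by simp
  note si = square_summable_inner[OF sq sq]
  show "x + y + z = x + (y + z)" by transfer (simp add: add.assoc)
  show "x + y = y + x" by transfer (simp add: add.commute)
  show "0 + x = x" by transfer simp
  show "- x + x = 0" by transfer simp
  show "x - y = x + - y" by (rule minus_ell2_def)
  show "a *\<^sub>R (x + y) = a *\<^sub>R x + a *\<^sub>R y"
    unfolding scaleR_ell2_def by transfer (simp add: distrib_left)
  show "(a + b) *\<^sub>R x = a *\<^sub>R x + b *\<^sub>R x"
    unfolding scaleR_ell2_def by transfer (simp add: distrib_right)
  show "a *\<^sub>R b *\<^sub>R x = (a * b) *\<^sub>R x"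
    unfolding scaleR_ell2_def by transfer (simp add: mult.assoc)
  show "1 *\<^sub>R x = x" unfolding scaleR_ell2_def by transfer simp
  show "sgn x = inverse (norm x) *\<^sub>R x" by (rule sgn_ell2_def)
  show "dist x y = norm (x - y)" by (rule dist_ell2_def)
  show "uniformity = (INF e\<in>{0<..}. principal {(x :: ell2, y). dist x y < e})"
    by (rule uniformity_ell2_def)
  show "open U = (\<forall>x\<in>U. \<forall>\<^sub>F (x', y) in uniformity. x' = x \<longrightarrow> y \<in> U)"
    by (rule open_ell2_def)
  show "inner x y = inner y x"
    unfolding inner_ell2_def by (simp add: inner_commute)
  show "inner (x + y) z = inner x z + inner y z"
    unfolding inner_ell2_def
    by (simp add: plus_ell2.rep_eq inner_add_left suminf_add[OF si si])
  show "inner (r *\<^sub>R x) y = r * inner x y"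
    unfolding inner_ell2_def scaleR_ell2_def
    by (simp add: scaleC_ell2.rep_eq suminf_mult[OF si] flip: scaleR_conv_of_real)
  show "0 \<le> inner x x"
    unfolding inner_ell2_def by (intro suminf_nonneg si) simp
  have "inner x x = 0 \<longleftrightarrow> (\<forall>n. ell2_nth x n = 0)"
    unfolding inner_ell2_def by (subst suminf_eq_zero_iff[OF si]) simp_all
  also have "\<dots> \<longleftrightarrow> x = 0" by transfer auto
  finally show "inner x x = 0 \<longleftrightarrow> x = 0" .
  show "norm x = sqrt (inner x x)"
    unfolding norm_ell2_def inner_ell2_def by (simp add: power2_norm_eq_inner)
qed

end

lemma vector_space_scaleC_ell2: "vector_space scaleC_ell2"
proof
  fix a b :: complex and x y :: ell2
  show "scaleC_ell2 a (x + y) = scaleC_ell2 a x + scaleC_ell2 a y"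
    by transfer (simp add: distrib_left)
  show "scaleC_ell2 (a + b) x = scaleC_ell2 a x + scaleC_ell2 b x"
    by transfer (simp add: distrib_right)
  show "scaleC_ell2 a (scaleC_ell2 b x) = scaleC_ell2 (a * b) x"
    by transfer (simp add: mult.assoc)
  show "scaleC_ell2 1 x = x" by transfer simp
qed

lemma norm_scaleC_ell2: "norm (scaleC_ell2 c x) = cmod c * norm x"
proof -
  have "summable (\<lambda>n. (cmod (ell2_nth x n))\<^sup>2)"
    using ell2_nth[of x] by simp
  from suminf_mult[OF this, of "(cmod c)\<^sup>2"] show ?thesis
    unfolding norm_ell2_def scaleC_ell2.rep_eq
    by (simp add: norm_mult power_mult_distrib real_sqrt_mult)
qed

lemma bounded_linear_scaleC_ell2: "bounded_linear (scaleC_ell2 c)"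
proof (rule bounded_linear_intro[where K = "cmod c"])
  interpret vector_space scaleC_ell2 by (rule vector_space_scaleC_ell2)
  show "scaleC_ell2 c (x + y) = scaleC_ell2 c x + scaleC_ell2 c y" for x y
    by (rule scale_right_distrib)
  show "scaleC_ell2 c (r *\<^sub>R x) = r *\<^sub>R scaleC_ell2 c x" for r x
    by (simp add: scaleR_ell2_def mult.commute)
  show "norm (scaleC_ell2 c x) \<le> norm x * cmod c" for x
    by (simp add: norm_scaleC_ell2)
qed


section \<open>Compact operators\<close>

text \<open>
  Elements of \<^typ>\<open>ell2 \<Rightarrow>\<^sub>L ell2\<close> are bounded and real-linear, so complex homogeneity is
  required separately. The norm of this type is the operator norm.
\<close>

definition compact_operators :: "(ell2 \<Rightarrow>\<^sub>L ell2) set" where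
  "compact_operators = {T.
     (\<forall>c x. blinfun_apply T (scaleC_ell2 c x) = scaleC_ell2 c (blinfun_apply T x)) \<and>
     compact (closure (blinfun_apply T ` cball 0 1))}"

definition scaleC_op :: "complex \<Rightarrow> (ell2 \<Rightarrow>\<^sub>L ell2) \<Rightarrow> (ell2 \<Rightarrow>\<^sub>L ell2)" where
  "scaleC_op c T = Blinfun (\<lambda>x. scaleC_ell2 c (blinfun_apply T x))"

lemma scaleC_op_apply: "blinfun_apply (scaleC_op c T) x = scaleC_ell2 c (blinfun_apply T x)"
  unfolding scaleC_op_def
  by (subst bounded_linear_Blinfun_apply)
    (auto intro: bounded_linear_compose[OF bounded_linear_scaleC_ell2] blinfun.bounded_linear_right)

lemma vector_space_scaleC_op: "vector_space scaleC_op"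
proof -
  interpret vector_space scaleC_ell2 by (rule vector_space_scaleC_ell2)
  show ?thesis
  proof
    fix a b :: complex and S T :: "ell2 \<Rightarrow>\<^sub>L ell2"
    show "scaleC_op a (S + T) = scaleC_op a S + scaleC_op a T"
      by (rule blinfun_eqI) (simp add: scaleC_op_apply blinfun.add_left scale_right_distrib)
    show "scaleC_op (a + b) T = scaleC_op a T + scaleC_op b T"
      by (rule blinfun_eqI) (simp add: scaleC_op_apply blinfun.add_left scale_left_distrib)
    show "scaleC_op a (scaleC_op b T) = scaleC_op (a * b) T"
      by (rule blinfun_eqI) (simp add: scaleC_op_apply)
    show "scaleC_op 1 T = T"
      by (rule blinfun_eqI) (simp add: scaleC_op_apply)
  qed
qed


section \<open>The domain in two complex variables and its norm\<close>

definition B_dom :: "real \<Rightarrow> real \<Rightarrow> (complex ^ 2) set" where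
  "B_dom p q = {z. cmod (z $ 1) powr p + cmod (z $ 2) powr q < 1}"

definition minkowski_functional :: "'a::real_vector set \<Rightarrow> 'a \<Rightarrow> real" where
  "minkowski_functional B z = Inf {t. 0 < t \<and> (1 / t) *\<^sub>R z \<in> B}"

lemma minkowski_functional_less_1_iff:
  assumes "0 < p" "0 < q"
  shows "minkowski_functional (B_dom p q) z < 1 \<longleftrightarrow> z \<in> B_dom p q"
proof -
  define S where "S = {t. 0 < t \<and> (1 / t) *\<^sub>R z \<in> B_dom p q}"
  define g where "g t = (cmod (z $ 1) / t) powr p + (cmod (z $ 2) / t) powr q" for t
  have S_iff: "t \<in> S \<longleftrightarrow> 0 < t \<and> g t < 1" for t
    by (auto simp: S_def B_dom_def g_def)
  have g1: "g 1 < 1 \<longleftrightarrow> z \<in> B_dom p q"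
    by (simp add: g_def B_dom_def)
  have bdd: "bdd_below S"
    by (rule bdd_belowI[of _ 0]) (simp add: S_def)
  have "(g \<longlongrightarrow> 0 powr p + 0 powr q) at_top"
    unfolding g_def using assms
    by (intro tendsto_add tendsto_powr' tendsto_divide_0[OF tendsto_const]
        filterlim_at_top_imp_at_infinity filterlim_ident)
      (auto intro: eventually_mono[OF eventually_gt_at_top[of 0]])
  then have "(g \<longlongrightarrow> 0) at_top" by simp
  then have "\<forall>\<^sub>F t in at_top. g t < 1"
    by (rule order_tendstoD) simp
  then have "\<forall>\<^sub>F t in at_top. g t < 1 \<and> 0 < t"
    using eventually_gt_at_top[of "0::real"] by eventually_elim simp
  then obtain t0 where "g t0 < 1" "0 < t0"
    using eventually_happens'[OF trivial_limit_at_top_linorder] by blast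
  then have ne: "S \<noteq> {}" using S_iff by blast
  have "Inf S < 1 \<longleftrightarrow> (\<exists>t\<in>S. t < 1)"
    by (rule cInf_less_iff[OF ne bdd])
  also have "\<dots> \<longleftrightarrow> z \<in> B_dom p q"
  proof
    assume "\<exists>t\<in>S. t < 1"
    then obtain t where t: "0 < t" "g t < 1" "t < 1" using S_iff by blast
    have "a \<le> a / t" if "0 \<le> a" for a :: real
      using that t by (simp add: le_divide_eq mult_left_le)
    then have "g 1 \<le> g t"
      unfolding g_def using assms by (intro add_mono powr_mono2) auto
    with t g1 show "z \<in> B_dom p q" by simp
  next
    assume "z \<in> B_dom p q"
    moreover have "(g \<longlongrightarrow> g 1) (at_left 1)"
      unfolding g_def using assms by (intro tendsto_intros) auto
    ultimately have "\<forall>\<^sub>F t in at_left 1. g t < 1"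
      using g1 order_tendstoD(2) by blast
    moreover have "\<forall>\<^sub>F t in at_left 1. t \<in> {0<..<(1::real)}"
      by (rule eventually_at_leftI[of 0]) auto
    ultimately have "\<forall>\<^sub>F t in at_left 1. t \<in> S \<and> t < 1"
      by eventually_elim (simp add: S_iff)
    then show "\<exists>t\<in>S. t < 1"
      using eventually_happens'[OF trivial_limit_at_left_real] by blast
  qed
  finally show ?thesis
    by (simp add: minkowski_functional_def S_def)
qed

end

(*
The space contains two operators T, S with |aT + bS| < 1 iff |a|^p + |b|^q < 1 for real a, b; the
argument uses only the underlying real Hilbert space structure.  Since q > 2, S is a
perturbation of T that is not felt to second order: |(1 - e s^2) T +- s S| <= 1 for all e > 0 and
small s.  Testing this inequality on a norm-attaining vector v of T, and on v + c w with w
orthogonal to v, gives S v = 0 and S w orthogonal to T v.  So T + sS splits along the space E of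
norm-attaining vectors: it agrees with the isometry T on E and maps the complement of E into the
complement of T E.  By compactness E has finite dimension and T has norm < 1 on its complement, hence
|T + sS| <= 1 for small s.  But 1 + s^q > 1 forces |T + sS| > 1.
*)

theory Submission
  imports Defs
begin

subsection \<open>Completeness of square-summable sequences\<close>

lemma norm_ell2_nth_le: "cmod (ell2_nth x n) \<le> norm x"
proof -
  have "summable (\<lambda>n. (cmod (ell2_nth x n))\<^sup>2)"
    using ell2_nth[of x] by simp
  from sum_le_suminf[OF this, of "{n}"]
  have "(cmod (ell2_nth x n))\<^sup>2 \<le> (\<Sum>n. (cmod (ell2_nth x n))\<^sup>2)"
    by simp
  then show ?thesis
    unfolding norm_ell2_def by (rule real_le_rsqrt)
qed

lemma ell2_nth_diff: "ell2_nth (x - y) n = ell2_nth x n - ell2_nth y n"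
  unfolding minus_ell2_def plus_ell2.rep_eq uminus_ell2.rep_eq by simp

lemma sum_ell2_nth_le: "(\<Sum>n<N. (cmod (ell2_nth x n))\<^sup>2) \<le> (norm x)\<^sup>2"
proof -
  have *: "summable (\<lambda>n. (cmod (ell2_nth x n))\<^sup>2)"
    using ell2_nth[of x] by simp
  show ?thesis
    using sum_le_suminf[OF *, of "{..<N}"] suminf_nonneg[OF *] by (simp add: norm_ell2_def)
qed

text \<open>Bounds on finite partial sums survive coordinatewise limits, so this criterion gives
  both square-summability and the norm bound of such a limit.\<close>

lemma ell2_bounded_by_partial_sums:
  assumes "\<And>N. (\<Sum>n<N. (cmod (x n))\<^sup>2) \<le> C\<^sup>2" "0 \<le> C"
  shows "\<exists>y. ell2_nth y = x \<and> norm y \<le> C"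
proof -
  have s: "summable (\<lambda>n. (cmod (x n))\<^sup>2)"
  proof (rule bounded_imp_summable)
    show "(\<Sum>n\<le>N. (cmod (x n))\<^sup>2) \<le> C\<^sup>2" for N
      using assms(1)[of "Suc N"] by (simp only: lessThan_Suc_atMost)
  qed simp
  then have y: "ell2_nth (Abs_ell2 x) = x"
    by (simp add: Abs_ell2_inverse)
  have "(\<Sum>n. (cmod (x n))\<^sup>2) \<le> C\<^sup>2"
    by (rule suminf_le_const[OF s assms(1)])
  then have "norm (Abs_ell2 x) \<le> C"
    unfolding norm_ell2_def y using assms(2) by (intro real_le_lsqrt)
  with y show ?thesis by blast
qed

text \<open>Coordinates converge because \<open>complex\<close> is complete. The Cauchy estimate
  bounds every partial sum of \<open>X i\<close> minus the coordinatewise limit, which turns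
  coordinatewise into norm convergence.\<close>

instance ell2 :: complete_space
proof
  fix X :: "nat \<Rightarrow> ell2"
  assume X: "Cauchy X"
  have "Cauchy (\<lambda>k. ell2_nth (X k) n)" for n
  proof (rule metric_CauchyI)
    fix e :: real assume "0 < e"
    then obtain M where M: "\<And>i j. i \<ge> M \<Longrightarrow> j \<ge> M \<Longrightarrow> dist (X i) (X j) < e"
      using metric_CauchyD[OF X \<open>0 < e\<close>] by blast
    show "\<exists>M. \<forall>i\<ge>M. \<forall>j\<ge>M. dist (ell2_nth (X i) n) (ell2_nth (X j) n) < e"
    proof (intro exI[of _ M] allI impI)
      fix i j assume "i \<ge> M" "j \<ge> M"
      with M[of i j] norm_ell2_nth_le[of "X i - X j" n]
      show "dist (ell2_nth (X i) n) (ell2_nth (X j) n) < e"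
        by (simp add: dist_norm ell2_nth_diff)
    qed
  qed
  then obtain l where l: "\<And>n. (\<lambda>k. ell2_nth (X k) n) \<longlonglongrightarrow> l n"
    unfolding Cauchy_convergent_iff convergent_LIMSEQ_iff by (rule that)
  have tail: "\<exists>y. ell2_nth y = (\<lambda>n. ell2_nth (X i) n - l n) \<and> norm y \<le> e"
    if "0 < e" and M: "\<And>j. j \<ge> M \<Longrightarrow> dist (X i) (X j) < e" for e i M
  proof (rule ell2_bounded_by_partial_sums)
    fix N
    have lim: "(\<lambda>j. \<Sum>n<N. (cmod (ell2_nth (X i) n - ell2_nth (X j) n))\<^sup>2)
        \<longlonglongrightarrow> (\<Sum>n<N. (cmod (ell2_nth (X i) n - l n))\<^sup>2)"
      by (intro tendsto_intros l)
    show "(\<Sum>n<N. (cmod (ell2_nth (X i) n - l n))\<^sup>2) \<le> e\<^sup>2"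
    proof (rule LIMSEQ_le_const2[OF lim], intro exI[of _ M] allI impI)
      fix j assume "M \<le> j"
      have "(norm (X i - X j))\<^sup>2 \<le> e\<^sup>2"
        using M[OF \<open>M \<le> j\<close>] by (intro power_mono) (auto simp: dist_norm)
      then show "(\<Sum>n<N. (cmod (ell2_nth (X i) n - ell2_nth (X j) n))\<^sup>2) \<le> e\<^sup>2"
        using sum_ell2_nth_le[where x = "X i - X j" and N = N] by (simp add: ell2_nth_diff)
    qed
  qed (use \<open>0 < e\<close> in simp)
  obtain M where M: "\<And>i j. i \<ge> M \<Longrightarrow> j \<ge> M \<Longrightarrow> dist (X i) (X j) < 1"
    using metric_CauchyD[OF X zero_less_one] by blast
  then obtain y where y: "ell2_nth y = (\<lambda>n. ell2_nth (X M) n - l n)"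
    using tail[OF zero_less_one M[OF order_refl]] by blast
  \<comment> \<open>Only the difference \<open>y\<close> was shown to be square-summable;
    subtracting it from \<open>X M\<close> realises \<open>l\<close> itself as an element of
    \<open>ell2\<close>.\<close>
  have L: "ell2_nth (X M - y) = l"
    by (rule ext) (simp add: ell2_nth_diff y)
  have "X \<longlonglongrightarrow> X M - y"
  proof (rule metric_LIMSEQ_I)
    fix e :: real assume "0 < e"
    then obtain K where K: "\<And>i j. i \<ge> K \<Longrightarrow> j \<ge> K \<Longrightarrow> dist (X i) (X j) < e / 2"
      using metric_CauchyD[OF X half_gt_zero[OF \<open>0 < e\<close>]] by blast
    show "\<exists>K. \<forall>i\<ge>K. dist (X i) (X M - y) < e"
    proof (intro exI[of _ K] allI impI)
      fix i assume "K \<le> i"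
      then obtain d where d: "ell2_nth d = (\<lambda>n. ell2_nth (X i) n - l n)" "norm d \<le> e / 2"
        using tail[OF half_gt_zero[OF \<open>0 < e\<close>] K] by blast
      have "d = X i - (X M - y)"
        by (subst ell2_nth_inject[symmetric]) (simp add: d(1) fun_eq_iff ell2_nth_diff[of "X i"] L)
      then show "dist (X i) (X M - y) < e"
        using d(2) \<open>0 < e\<close> by (simp add: dist_norm)
    qed
  qed
  then show "convergent X" by (rule convergentI)
qed

subsection \<open>Perturbations that are flat to second order\<close>

text \<open>At \<open>t = a * k\<close> with \<open>k\<close> small and positive, the left side is
  linear in \<open>k\<close> and the right side quadratic.\<close>

lemma zero_if_linear_le_quadratic:
  fixes a c :: real
  assumes "\<And>t. 2 * t * a \<le> t\<^sup>2 * c"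
  shows "a = 0"
proof (rule ccontr)
  assume "a \<noteq> 0"
  \<comment> \<open>The added 1 keeps the denominator positive and forces \<open>k * c < 1\<close>
    for either sign of \<open>c\<close>.\<close>
  define k where "k = 1 / (\<bar>c\<bar> + 1)"
  have k: "0 < k" "k * c < 1"
    by (auto simp: k_def field_simps abs_if)
  have "(2 * a\<^sup>2) * k \<le> a\<^sup>2 * k * (k * c)"
    using assms[of "a * k"] by (simp add: power2_eq_square mult_ac)
  also have "\<dots> < a\<^sup>2 * k * 1"
    using k \<open>a \<noteq> 0\<close> by (intro mult_strict_left_mono) auto
  finally show False using k \<open>a \<noteq> 0\<close> by simp
qed

lemma norm_add_scaleR_sq:
  fixes x y :: "'a::real_inner"
  shows "(norm (x + c *\<^sub>R y))\<^sup>2 = (norm x)\<^sup>2 + 2 * c * inner x y + c\<^sup>2 * (norm y)\<^sup>2"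
  unfolding power2_norm_eq_inner
  by (simp add: inner_add_left inner_add_right inner_commute[of y x] power2_eq_square
      algebra_simps)

lemma norm_blinfun_le_1:
  assumes "norm A \<le> 1"
  shows "norm (blinfun_apply A x) \<le> norm x"
  using order_trans[OF norm_blinfun mult_right_mono[OF assms norm_ge_zero]] by simp

text \<open>The function \<open>(norm (T x))\<^sup>2 - (norm x)\<^sup>2\<close> is nowhere positive
  and vanishes at \<open>v\<close>, so its derivative at \<open>v\<close> is zero in every direction
  \<open>w\<close>; in Hilbert space terms, T* T v = v.\<close>

lemma inner_image_isometric_vector:
  fixes T :: "'a::real_inner \<Rightarrow>\<^sub>L 'b::real_inner"
  assumes T: "norm T \<le> 1" and v: "norm (T v) = norm v"
  shows "inner (T v) (T w) = inner v w"
proof -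
  define a where "a = inner (T v) (T w) - inner v w"
  have *: "2 * t * a \<le> t\<^sup>2 * (norm w)\<^sup>2" for t
  proof -
    have "norm (T v + t *\<^sub>R T w) \<le> norm (v + t *\<^sub>R w)"
      using norm_blinfun_le_1[OF T, of "v + t *\<^sub>R w"]
      by (simp add: blinfun.add_right blinfun.scaleR_right)
    then have "(norm (T v + t *\<^sub>R T w))\<^sup>2 \<le> (norm (v + t *\<^sub>R w))\<^sup>2"
      by (rule power_mono) simp
    moreover have "0 \<le> t\<^sup>2 * (norm (T w))\<^sup>2"
      by simp
    ultimately show ?thesis
      unfolding norm_add_scaleR_sq v a_def right_diff_distrib by linarith
  qed
  show ?thesis
    using zero_if_linear_le_quadratic[OF *] by (simp add: a_def)
qed

section \<open>Consequences of flatness at norm-attaining vectors\<close>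

text \<open>However small \<open>e\<close> is, lowering the coefficient of \<open>T\<close> by
  \<open>e * s\<^sup>2\<close> pays for adding or subtracting \<open>s *\<^sub>R S\<close>. Having
  both signs lets cross terms cancel.\<close>

locale flat_perturbation =
  fixes T S :: "'a::real_inner \<Rightarrow>\<^sub>L 'b::real_inner"
  assumes T_le_1: "norm T \<le> 1"
    and flat: "0 < e \<Longrightarrow> \<forall>\<^sub>F s in at_right 0.
      norm ((1 - e * s\<^sup>2) *\<^sub>R T + s *\<^sub>R S) \<le> 1 \<and> norm ((1 - e * s\<^sup>2) *\<^sub>R T - s *\<^sub>R S) \<le> 1"
begin

lemma flat_imp_le:
  assumes "0 < e"
  shows "\<forall>\<^sub>F s in at_right 0. 0 < s \<and> 0 < 1 - e * s\<^sup>2 \<and>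
    (\<forall>x. norm ((1 - e * s\<^sup>2) *\<^sub>R T x + s *\<^sub>R S x) \<le> norm x \<and>
         norm ((1 - e * s\<^sup>2) *\<^sub>R T x - s *\<^sub>R S x) \<le> norm x)"
proof -
  have "((\<lambda>s. 1 - e * s\<^sup>2) \<longlongrightarrow> 1 - e * 0\<^sup>2) (at_right 0)"
    by (intro tendsto_intros)
  then have "\<forall>\<^sub>F s in at_right 0. 0 < 1 - e * s\<^sup>2"
    by (rule order_tendstoD) simp
  with flat[OF assms] eventually_at_right_less[of 0] show ?thesis
  proof eventually_elim
    case (elim s)
    then show ?case
      using norm_blinfun_le_1[of "(1 - e * s\<^sup>2) *\<^sub>R T + s *\<^sub>R S"]
        norm_blinfun_le_1[of "(1 - e * s\<^sup>2) *\<^sub>R T - s *\<^sub>R S"]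
      by (simp add: blinfun.bilinear_simps)
  qed
qed

text \<open>Adding the squared inequalities for both signs cancels the cross term. What
  \<open>S v\<close> contributes, \<open>s\<^sup>2 * (norm (S v))\<^sup>2\<close>, is then at most
  the loss \<open>2 * e * s\<^sup>2 * (norm v)\<^sup>2\<close>; divide by \<open>s\<^sup>2\<close>
  and let \<open>e\<close> tend to 0.\<close>

lemma perturbation_vanishes:
  assumes v: "norm (T v) = norm v"
  shows "S v = 0"
proof -
  have *: "(norm (S v))\<^sup>2 \<le> 2 * e * (norm v)\<^sup>2" if e: "0 < e" for e
  proof -
    obtain s where s: "0 < s" "0 < 1 - e * s\<^sup>2"
      and le: "norm ((1 - e * s\<^sup>2) *\<^sub>R T v + s *\<^sub>R S v) \<le> norm v"
        "norm ((1 - e * s\<^sup>2) *\<^sub>R T v - s *\<^sub>R S v) \<le> norm v"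
      using eventually_happens'[OF trivial_limit_at_right_real flat_imp_le[OF e]] by auto
    define z where "z = 1 - e * s\<^sup>2"
    have "(norm (z *\<^sub>R T v + s *\<^sub>R S v))\<^sup>2 \<le> (norm v)\<^sup>2"
         "(norm (z *\<^sub>R T v + (- s) *\<^sub>R S v))\<^sup>2 \<le> (norm v)\<^sup>2"
      using le by (auto simp: z_def intro!: power_mono)
    then have "z\<^sup>2 * (norm v)\<^sup>2 + s\<^sup>2 * (norm (S v))\<^sup>2 \<le> (norm v)\<^sup>2"
      unfolding norm_add_scaleR_sq by (simp add: power_mult_distrib v)
    moreover have "(1 - 2 * e * s\<^sup>2) * (norm v)\<^sup>2 \<le> z\<^sup>2 * (norm v)\<^sup>2"
      by (intro mult_right_mono) (simp_all add: z_def power2_diff)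
    ultimately have "s\<^sup>2 * (norm (S v))\<^sup>2 \<le> s\<^sup>2 * (2 * e * (norm v)\<^sup>2)"
      by (simp add: algebra_simps)
    then show ?thesis using s(1) by simp
  qed
  have "((\<lambda>e. 2 * e * (norm v)\<^sup>2) \<longlongrightarrow> 2 * 0 * (norm v)\<^sup>2) (at_right 0)"
    by (intro tendsto_intros)
  then have "(norm (S v))\<^sup>2 \<le> 2 * 0 * (norm v)\<^sup>2"
    by (rule tendsto_lowerbound)
      (auto intro: eventually_mono[OF eventually_at_right_less[of 0]] *)
  then show ?thesis by simp
qed

text \<open>Test on \<open>v + (l * s) *\<^sub>R w\<close>. Since \<open>S v = 0\<close> and
  \<open>T v\<close> is orthogonal to \<open>T w\<close>, the remaining cross term is of order
  \<open>s\<^sup>2\<close>, like the loss and the growth of the test vector. Dividing by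
  \<open>s\<^sup>2\<close> leaves an inequality linear against quadratic in
  \<open>l\<close>.\<close>

lemma image_orthogonal_perturbation:
  assumes v: "norm (T v) = norm v" and vw: "inner v w = 0"
  shows "inner (T v) (S w) = 0"
proof -
  define a where "a = inner (T v) (S w)"
  have *: "2 * l * ((1 - e * s\<^sup>2) * a) \<le> 2 * e * (norm v)\<^sup>2 + l\<^sup>2 * (norm w)\<^sup>2"
    if "0 < s" "0 < 1 - e * s\<^sup>2"
      and le: "\<forall>x. norm ((1 - e * s\<^sup>2) *\<^sub>R T x + s *\<^sub>R S x) \<le> norm x" for e s l
  proof -
    define z where "z = 1 - e * s\<^sup>2"
    define y where "y = z *\<^sub>R T w + s *\<^sub>R S w"
    have "norm (z *\<^sub>R T v + (l * s) *\<^sub>R y) \<le> norm (v + (l * s) *\<^sub>R w)"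
      using le[rule_format, of "v + (l * s) *\<^sub>R w"] perturbation_vanishes[OF v]
      by (simp add: blinfun.bilinear_simps y_def z_def scaleR_add_right algebra_simps)
    then have "(norm (z *\<^sub>R T v + (l * s) *\<^sub>R y))\<^sup>2 \<le> (norm (v + (l * s) *\<^sub>R w))\<^sup>2"
      by (rule power_mono) simp
    moreover have "(norm (z *\<^sub>R T v))\<^sup>2 = z\<^sup>2 * (norm v)\<^sup>2"
      by (simp add: power_mult_distrib v)
    \<comment> \<open>The \<open>T w\<close> part of \<open>y\<close> drops out; the
      \<open>S w\<close> part brings the second factor \<open>s\<close>.\<close>
    moreover have "2 * (l * s) * inner (z *\<^sub>R T v) y = s\<^sup>2 * (2 * l * (z * a))"
      using inner_image_isometric_vector[OF T_le_1 v, of w] vw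
      by (simp add: y_def inner_add_right a_def power2_eq_square)
    moreover have "0 \<le> (l * s)\<^sup>2 * (norm y)\<^sup>2" by simp
    moreover have "(1 - 2 * e * s\<^sup>2) * (norm v)\<^sup>2 \<le> z\<^sup>2 * (norm v)\<^sup>2"
      by (intro mult_right_mono) (simp_all add: z_def power2_diff)
    moreover have "2 * (l * s) * inner v w = 0"
      by (simp add: vw)
    ultimately have "s\<^sup>2 * (2 * l * (z * a)) + (1 - 2 * e * s\<^sup>2) * (norm v)\<^sup>2
        \<le> (norm v)\<^sup>2 + (l * s)\<^sup>2 * (norm w)\<^sup>2"
      unfolding norm_add_scaleR_sq by linarith
    then have "s\<^sup>2 * (2 * l * (z * a)) \<le> s\<^sup>2 * (2 * e * (norm v)\<^sup>2 + l\<^sup>2 * (norm w)\<^sup>2)"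
      by (simp add: algebra_simps power_mult_distrib)
    then show ?thesis using \<open>0 < s\<close> by (simp add: z_def)
  qed
  \<comment> \<open>First \<open>s\<close> tends to 0 with \<open>e\<close> fixed, then
    \<open>e\<close> tends to 0.\<close>
  have **: "2 * l * a \<le> 2 * e * (norm v)\<^sup>2 + l\<^sup>2 * (norm w)\<^sup>2" if "0 < e" for e l
  proof (rule tendsto_upperbound)
    have "((\<lambda>s. 2 * l * ((1 - e * s\<^sup>2) * a)) \<longlongrightarrow> 2 * l * ((1 - e * 0\<^sup>2) * a)) (at_right 0)"
      by (intro tendsto_intros)
    then show "((\<lambda>s. 2 * l * ((1 - e * s\<^sup>2) * a)) \<longlongrightarrow> 2 * l * a) (at_right 0)"
      by simp
    show "\<forall>\<^sub>F s in at_right 0. 2 * l * ((1 - e * s\<^sup>2) * a) \<le> 2 * e * (norm v)\<^sup>2 + l\<^sup>2 * (norm w)\<^sup>2"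
      using flat_imp_le[OF that] by eventually_elim (blast intro: *)
  qed simp
  have "2 * l * a \<le> l\<^sup>2 * (norm w)\<^sup>2" for l
  proof (rule tendsto_lowerbound)
    have "((\<lambda>e. 2 * e * (norm v)\<^sup>2 + l\<^sup>2 * (norm w)\<^sup>2) \<longlongrightarrow> 2 * 0 * (norm v)\<^sup>2 + l\<^sup>2 * (norm w)\<^sup>2)
        (at_right 0)"
      by (intro tendsto_intros)
    then show "((\<lambda>e. 2 * e * (norm v)\<^sup>2 + l\<^sup>2 * (norm w)\<^sup>2) \<longlongrightarrow> l\<^sup>2 * (norm w)\<^sup>2) (at_right 0)"
      by simp
    show "\<forall>\<^sub>F e in at_right 0. 2 * l * a \<le> 2 * e * (norm v)\<^sup>2 + l\<^sup>2 * (norm w)\<^sup>2"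
      by (rule eventually_mono[OF eventually_at_right_less[of 0]]) (rule **)
  qed simp
  then show ?thesis
    unfolding a_def by (rule zero_if_linear_le_quadratic)
qed


text \<open>Split \<open>x\<close> into its projection \<open>v\<close> onto the span of
  \<open>F\<close> and the rest \<open>w\<close>. The operator \<open>T + s *\<^sub>R S\<close>
  preserves the norm of \<open>v\<close> and keeps the images of \<open>v\<close> and
  \<open>w\<close> orthogonal, so by Pythagoras all the excess norm comes from
  \<open>w\<close>.\<close>

lemma project_off_isometric_vectors:
  assumes F: "finite F" "pairwise orthogonal F"
    and iso: "\<And>f. f \<in> F \<Longrightarrow> norm f = 1 \<and> norm (T f) = 1"
    and x: "norm x < norm ((T + s *\<^sub>R S) x)"
  obtains w where "norm w < norm ((T + s *\<^sub>R S) w)" "\<And>f. f \<in> F \<Longrightarrow> inner f w = 0"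
proof -
  define v where "v = (\<Sum>f\<in>F. inner x f *\<^sub>R f)"
  define w where "w = x - v"
  have orth: "inner f w = 0" if "f \<in> F" for f
  proof -
    have "inner f v = (\<Sum>g\<in>F. if g = f then inner x f else 0)"
      unfolding v_def inner_sum_right
    proof (rule sum.cong)
      fix g assume "g \<in> F"
      then show "inner f (inner x g *\<^sub>R g) = (if g = f then inner x f else 0)"
        using pairwiseD[OF F(2) \<open>f \<in> F\<close>, of g] iso[OF \<open>f \<in> F\<close>]
        by (auto simp: orthogonal_def norm_eq_1)
    qed simp
    then show ?thesis
      using F(1) \<open>f \<in> F\<close> by (simp add: w_def inner_diff_right inner_commute)
  qed
  \<comment> \<open>Preserving inner products with each \<open>f\<close> in \<open>F\<close>,
    \<open>T\<close> is isometric on their span, so \<open>v\<close> is again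
    norm-attaining.\<close>
  have Tf: "inner (T f) (T y) = inner f y" if "f \<in> F" for f y
    using inner_image_isometric_vector[OF T_le_1] iso[OF that] by simp
  have "inner (T v) (T v) = inner v v"
    by (simp add: v_def blinfun.sum_right blinfun.scaleR_right inner_sum_left inner_sum_right Tf)
  then have Tv: "norm (T v) = norm v"
    by (simp add: norm_eq_sqrt_inner)
  have vw: "inner v w = 0"
    by (simp add: v_def inner_sum_left orth)
  define A where "A = T + s *\<^sub>R S"
  have "inner (T v) (A w) = 0"
    using inner_image_isometric_vector[OF T_le_1 Tv, of w] image_orthogonal_perturbation[OF Tv vw] vw
    by (simp add: A_def blinfun.bilinear_simps inner_add_right)
  moreover have "A x = T v + A w"
    using perturbation_vanishes[OF Tv]
    by (simp add: w_def A_def blinfun.bilinear_simps algebra_simps)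
  ultimately have "(norm (A x))\<^sup>2 = (norm v)\<^sup>2 + (norm (A w))\<^sup>2"
    using norm_add_scaleR_sq[of "T v" 1 "A w"] Tv by simp
  moreover have "(norm x)\<^sup>2 = (norm v)\<^sup>2 + (norm w)\<^sup>2"
    using norm_add_scaleR_sq[of v 1 w] vw by (simp add: w_def)
  moreover have "(norm x)\<^sup>2 < (norm (A x))\<^sup>2"
    using x by (intro power_strict_mono) (simp_all add: A_def)
  ultimately have "(norm w)\<^sup>2 < (norm (A w))\<^sup>2"
    by linarith
  then have "norm w < norm (A w)"
    by (rule power_less_imp_less_base) simp
  then show thesis
    using that orth unfolding A_def by blast
qed

end

section \<open>Compactness and the supply of norm-attaining vectors\<close>

text \<open>Images near a common \<open>y\<close> of norm at least 1 force
  \<open>norm (x i + x j)\<close> to be nearly 2; by the parallelogram law the unit vectors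
  \<open>x i\<close> and \<open>x j\<close> are then close.\<close>

lemma Cauchy_if_image_norm_preserving:
  fixes T :: "'a::real_inner \<Rightarrow>\<^sub>L 'b::real_inner"
  assumes T: "norm T \<le> 1" and x: "\<And>n. norm (x n) = 1"
    and lim: "(\<lambda>n. T (x n)) \<longlonglongrightarrow> y" and y: "1 \<le> norm y"
  shows "Cauchy x"
proof (rule metric_CauchyI)
  fix e :: real assume "0 < e"
  \<comment> \<open>The parallelogram law gives squared distance below
    \<open>4 - (2 - 2 * d)\<^sup>2\<close>, which is at most \<open>8 * d\<close>;
    \<open>d \<le> 1\<close> keeps \<open>2 - 2 * d\<close> nonnegative for squaring.\<close>
  define d where "d = min 1 (e\<^sup>2 / 8)"
  have d: "0 < d" "d \<le> 1" "8 * d \<le> e\<^sup>2" using \<open>0 < e\<close> by (auto simp: d_def)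
  obtain M where M: "\<And>n. n \<ge> M \<Longrightarrow> norm (T (x n) - y) < d"
    using LIMSEQ_D[OF lim d(1)] by blast
  show "\<exists>M. \<forall>i\<ge>M. \<forall>j\<ge>M. dist (x i) (x j) < e"
  proof (intro exI[of _ M] allI impI)
    fix i j assume "M \<le> i" "M \<le> j"
    have "2 * norm y = norm (T (x i) + T (x j) - ((T (x i) - y) + (T (x j) - y)))"
      by (simp add: algebra_simps flip: scaleR_2)
    also have "\<dots> \<le> norm (T (x i) + T (x j)) + (norm (T (x i) - y) + norm (T (x j) - y))"
      by (rule order_trans[OF norm_triangle_ineq4 add_left_mono[OF norm_triangle_ineq]])
    also have "norm (T (x i) + T (x j)) \<le> norm (x i + x j)"
      using norm_blinfun_le_1[OF T, of "x i + x j"] by (simp add: blinfun.add_right)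
    finally have "2 - 2 * d < norm (x i + x j)"
      using M[OF \<open>M \<le> i\<close>] M[OF \<open>M \<le> j\<close>] y by simp
    then have "(2 - 2 * d)\<^sup>2 < (norm (x i + x j))\<^sup>2"
      using d by (intro power_strict_mono) auto
    moreover have "(norm (x i + x j))\<^sup>2 + (norm (x i - x j))\<^sup>2 = 4"
      using norm_add_scaleR_sq[of "x i" 1 "x j"] norm_add_scaleR_sq[of "x i" "-1" "x j"] x by simp
    moreover have "(2 - 2 * d)\<^sup>2 = 4 - 8 * d + 4 * d\<^sup>2"
      by (simp add: power2_diff)
    moreover have "0 \<le> d\<^sup>2" by simp
    ultimately have "(norm (x i - x j))\<^sup>2 < e\<^sup>2"
      using d(3) by linarith
    then show "dist (x i) (x j) < e"
      using \<open>0 < e\<close> by (simp add: dist_norm power_less_imp_less_base)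
  qed
qed

locale flat_compact_perturbation = flat_perturbation T S
  for T S :: "'a::{real_inner,complete_space} \<Rightarrow>\<^sub>L 'b::real_inner" +
  assumes compact_T: "compact (closure (T ` cball 0 1))"
begin

text \<open>Take \<open>s\<close> tending to 0 with \<open>norm (T + s *\<^sub>R S) > 1\<close>, and
  unit witnesses of this projected off \<open>F\<close>. Compactness makes their images under
  \<open>T\<close> converge along a subsequence, and the witnesses themselves then converge to the
  required \<open>x\<close>.\<close>

lemma extend_isometric_orthonormal_set:
  assumes F: "finite F" "pairwise orthogonal F"
    and iso: "\<And>f. f \<in> F \<Longrightarrow> norm f = 1 \<and> norm (T f) = 1"
    and large: "\<And>d. 0 < d \<Longrightarrow> \<exists>s. 0 < s \<and> s < d \<and> 1 < norm (T + s *\<^sub>R S)"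
  obtains x where "norm x = 1" "norm (T x) = 1" "\<And>f. f \<in> F \<Longrightarrow> inner f x = 0"
proof -
  have "\<exists>s w. 0 < s \<and> s < inverse (real (Suc n)) \<and> norm w = 1 \<and> 1 < norm ((T + s *\<^sub>R S) w)
      \<and> (\<forall>f\<in>F. inner f w = 0)" for n
  proof -
    obtain s where s: "0 < s" "s < inverse (real (Suc n))" "1 < norm (T + s *\<^sub>R S)"
      using large[of "inverse (real (Suc n))"] by auto
    obtain x where "norm x < norm ((T + s *\<^sub>R S) x)"
      using norm_blinfun_bound[of 1 "T + s *\<^sub>R S"] s(3)
      by (metis mult_1 not_le zero_le_one)
    from project_off_isometric_vectors[OF F iso this]
    obtain w where w: "norm w < norm ((T + s *\<^sub>R S) w)" "\<And>f. f \<in> F \<Longrightarrow> inner f w = 0"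
      by blast
    then have "w \<noteq> 0" by auto
    then have "norm ((T + s *\<^sub>R S) (w /\<^sub>R norm w)) = norm ((T + s *\<^sub>R S) w) / norm w"
      by (simp only: blinfun.scaleR_right) (simp add: divide_inverse mult.commute)
    also have "\<dots> > 1" using w \<open>w \<noteq> 0\<close> by simp
    finally show ?thesis
      using s w \<open>w \<noteq> 0\<close> by (intro exI[of _ s] exI[of _ "w /\<^sub>R norm w"]) auto
  qed
  then obtain s w where s: "\<And>n. 0 < s n" "\<And>n. s n < inverse (real (Suc n))"
    and w: "\<And>n. norm (w n) = 1" "\<And>n. 1 < norm ((T + s n *\<^sub>R S) (w n))"
      "\<And>n f. f \<in> F \<Longrightarrow> inner f (w n) = 0"
    by metis
  have s0: "s \<longlonglongrightarrow> 0"
    by (rule tendsto_sandwich[OF _ _ tendsto_const LIMSEQ_inverse_real_of_nat])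
      (use s in \<open>auto intro!: always_eventually less_imp_le\<close>)
  have "T (w n) \<in> closure (T ` cball 0 1)" for n
    using w(1)[of n] closure_subset by fastforce
  then obtain y r where r: "strict_mono r" and y: "(\<lambda>n. T (w (r n))) \<longlonglongrightarrow> y"
    using compact_T[unfolded compact_def, rule_format, of "\<lambda>n. T (w n)"] by (auto simp: o_def)
  have sr: "(\<lambda>n. s (r n)) \<longlonglongrightarrow> 0"
    using LIMSEQ_subseq_LIMSEQ[OF s0 r] by (simp add: o_def)
  \<comment> \<open>Each witness satisfies \<open>norm (T (w n)) > 1 - s n * norm S\<close>, and
    \<open>s n\<close> tends to 0.\<close>
  have "1 \<le> norm y"
  proof (rule tendsto_lowerbound)
    have "(\<lambda>n. norm (T (w (r n))) + s (r n) * norm S) \<longlonglongrightarrow> norm y + 0 * norm S"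
      by (intro tendsto_intros y sr)
    then show "(\<lambda>n. norm (T (w (r n))) + s (r n) * norm S) \<longlonglongrightarrow> norm y" by simp
    show "\<forall>\<^sub>F n in sequentially. 1 \<le> norm (T (w (r n))) + s (r n) * norm S"
    proof (rule always_eventually, rule allI)
      fix n
      have "1 < norm (T (w (r n)) + s (r n) *\<^sub>R S (w (r n)))"
        using w(2)[of "r n"] by (simp add: blinfun.bilinear_simps)
      also have "\<dots> \<le> norm (T (w (r n))) + norm (s (r n) *\<^sub>R S (w (r n)))"
        by (rule norm_triangle_ineq)
      also have "norm (s (r n) *\<^sub>R S (w (r n))) \<le> s (r n) * norm S"
        using norm_blinfun[of S "w (r n)"] w(1)[of "r n"] s(1)[of "r n"] by simp
      finally show "1 \<le> norm (T (w (r n))) + s (r n) * norm S" by simp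
    qed
  qed simp
  have "Cauchy (\<lambda>n. w (r n))"
    by (rule Cauchy_if_image_norm_preserving[OF T_le_1 w(1) y \<open>1 \<le> norm y\<close>])
  then obtain x where x: "(\<lambda>n. w (r n)) \<longlonglongrightarrow> x"
    by (auto simp: Cauchy_convergent_iff convergent_def)
  show thesis
  proof (rule that)
    show x1: "norm x = 1"
      using tendsto_norm[OF x] by (simp add: w(1) LIMSEQ_const_iff)
    have "T x = y"
      by (rule LIMSEQ_unique[OF _ y]) (intro tendsto_intros x)
    then show "norm (T x) = 1"
      using norm_blinfun_le_1[OF T_le_1, of x] x1 \<open>1 \<le> norm y\<close> by simp
    show "inner f x = 0" if "f \<in> F" for f
      using tendsto_inner[OF tendsto_const[of f] x] by (simp add: w(3)[OF that] LIMSEQ_const_iff)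
  qed
qed

text \<open>Otherwise the extension step iterates to orthonormal sets of every finite size whose
  images under \<open>T\<close> are again orthonormal, contradicting total boundedness of the image
  of the unit ball.\<close>

theorem norm_add_small_le_1:
  "\<exists>d>0. \<forall>s. 0 < s \<longrightarrow> s < d \<longrightarrow> norm (T + s *\<^sub>R S) \<le> 1"
proof (rule ccontr)
  assume "\<not> ?thesis"
  then have large: "\<exists>s. 0 < s \<and> s < d \<and> 1 < norm (T + s *\<^sub>R S)" if "0 < d" for d
    using that by (auto simp: not_le)
  have ex: "\<exists>F. finite F \<and> card F = n \<and> pairwise orthogonal F \<and> (\<forall>f\<in>F. norm f = 1 \<and> norm (T f) = 1)"
    for n
  proof (induction n)
    case 0
    then show ?case by (intro exI[of _ "{}"]) simp
  next
    case (Suc n)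
    then obtain F where F: "finite F" "card F = n" "pairwise orthogonal F"
      "\<And>f. f \<in> F \<Longrightarrow> norm f = 1 \<and> norm (T f) = 1"
      by blast
    from extend_isometric_orthonormal_set[OF F(1,3,4) large]
    obtain x where x: "norm x = 1" "norm (T x) = 1" "\<And>f. f \<in> F \<Longrightarrow> inner f x = 0"
      by blast
    have "x \<notin> F" using x(1) x(3)[of x] by (auto simp: norm_eq_1)
    moreover have "pairwise orthogonal (insert x F)"
      unfolding pairwise_insert using F(3) x(3) by (simp add: orthogonal_def[of x] orthogonal_def[of _ x] inner_commute[of x])
    ultimately show ?case
      using F x by (intro exI[of _ "insert x F"]) auto
  qed
  \<comment> \<open>Points in one ball of radius 1/2 are less than 1 apart, whereas orthonormal
    images have squared distance 2. One vector more than there are balls gives a collision.\<close>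
  obtain K where K: "finite K" "closure (T ` cball 0 1) \<subseteq> (\<Union>k\<in>K. ball k (1 / 2))"
    using compact_T unfolding compact_eq_totally_bounded by (metis zero_less_divide_1_iff zero_less_numeral)
  obtain F where F: "finite F" "card F = Suc (card K)" "pairwise orthogonal F"
    "\<And>f. f \<in> F \<Longrightarrow> norm f = 1 \<and> norm (T f) = 1"
    using ex by blast
  have "\<exists>k\<in>K. T f \<in> ball k (1 / 2)" if "f \<in> F" for f
  proof -
    have "T f \<in> closure (T ` cball 0 1)"
      using F(4)[OF that] closure_subset by fastforce
    with K(2) show ?thesis by blast
  qed
  then obtain c where c: "\<And>f. f \<in> F \<Longrightarrow> c f \<in> K" "\<And>f. f \<in> F \<Longrightarrow> T f \<in> ball (c f) (1 / 2)"
    by metis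
  have "card (c ` F) \<le> card K"
    using c(1) K(1) by (intro card_mono) auto
  then have "\<not> inj_on c F"
    using F(2) by (intro pigeonhole) simp
  then obtain f g where fg: "f \<in> F" "g \<in> F" "f \<noteq> g" "c f = c g"
    by (auto simp: inj_on_def)
  have "inner (T f) (T g) = 0"
    using inner_image_isometric_vector[OF T_le_1, of f g] F(4)[OF fg(1)] pairwiseD[OF F(3) fg(1-3)]
    by (simp add: orthogonal_def)
  then have "(norm (T f - T g))\<^sup>2 = 2"
    using norm_add_scaleR_sq[of "T f" "-1" "T g"] F(4) fg by simp
  moreover have "norm (T f - T g) \<le> 1"
    using c(2)[OF fg(1)] c(2)[OF fg(2)] fg(4) dist_triangle_half_r[of "c f" "T f" 1 "T g"]
    by (simp add: dist_norm)
  then have "(norm (T f - T g))\<^sup>2 \<le> 1"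
    by (simp add: power_le_one)
  ultimately show False by simp
qed

end

subsection \<open>The embedding\<close>

lemma scaleC_op_of_real: "scaleC_op (complex_of_real r) A = r *\<^sub>R A"
  by (rule blinfun_eqI) (simp add: scaleC_op_apply scaleR_ell2_def blinfun.scaleR_left)

text \<open>The first term is at most \<open>1 - e * s\<^sup>2\<close>, its base lying between 0 and
  1 and its exponent being at least 1. The second is \<open>s powr (q - 2) * s\<^sup>2\<close>,
  whose first factor falls below \<open>e\<close> because \<open>q > 2\<close>.\<close>

lemma eventually_powr_sum_less_1:
  fixes e p q :: real
  assumes "0 < e" "1 \<le> p" "2 < q"
  shows "\<forall>\<^sub>F s in at_right 0. 0 < s \<and> \<bar>1 - e * s\<^sup>2\<bar> powr p + s powr q < 1"
proof -
  have "((\<lambda>s. 1 - e * s\<^sup>2) \<longlongrightarrow> 1 - e * 0\<^sup>2) (at_right 0)"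
    by (intro tendsto_intros)
  then have pos: "\<forall>\<^sub>F s in at_right 0. 0 < 1 - e * s\<^sup>2"
    by (rule order_tendstoD) simp
  have "((\<lambda>s. s powr (q - 2)) \<longlongrightarrow> 0 powr (q - 2)) (at_right 0)"
    by (rule tendsto_powr') (use assms in \<open>auto intro!: tendsto_intros eventually_mono[OF eventually_at_right_less[of 0]]\<close>)
  then have "\<forall>\<^sub>F s in at_right 0. s powr (q - 2) < e"
    by (rule order_tendstoD) (use assms in simp)
  with pos eventually_at_right_less[of 0] show ?thesis
  proof eventually_elim
    case (elim s)
    have "\<bar>1 - e * s\<^sup>2\<bar> powr p \<le> (1 - e * s\<^sup>2) powr 1"
      using elim assms by (simp only: abs_of_pos) (intro powr_mono', auto)
    also have "\<dots> = 1 - e * s\<^sup>2"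
      using elim by simp
    finally have "\<bar>1 - e * s\<^sup>2\<bar> powr p \<le> 1 - e * s\<^sup>2" .
    moreover have "s powr q < e * s\<^sup>2"
    proof -
      have "s powr q = s powr (q - 2) * s powr 2"
        by (simp flip: powr_add)
      also have "\<dots> = s powr (q - 2) * s\<^sup>2"
        using elim by simp
      also have "\<dots> < e * s\<^sup>2"
        using elim by (intro mult_strict_right_mono) auto
      finally show ?thesis .
    qed
    ultimately show ?case using elim(2) by linarith
  qed
qed

theorem mainTheorem5:
  fixes p q :: real
  assumes "2 < p" and "2 < q"
  shows "\<not> (\<exists>\<Phi> :: complex ^ 2 \<Rightarrow> (ell2 \<Rightarrow>\<^sub>L ell2).
            Vector_Spaces.linear (*s) scaleC_op \<Phi> \<and>
            range \<Phi> \<subseteq> compact_operators \<and>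
            (\<forall>z. norm (\<Phi> z) = minkowski_functional (B_dom p q) z))"
proof
  assume "\<exists>\<Phi> :: complex ^ 2 \<Rightarrow> (ell2 \<Rightarrow>\<^sub>L ell2).
            Vector_Spaces.linear (*s) scaleC_op \<Phi> \<and>
            range \<Phi> \<subseteq> compact_operators \<and>
            (\<forall>z. norm (\<Phi> z) = minkowski_functional (B_dom p q) z)"
  then obtain \<Phi> :: "complex ^ 2 \<Rightarrow> (ell2 \<Rightarrow>\<^sub>L ell2)"
    where lin: "Vector_Spaces.linear (*s) scaleC_op \<Phi>"
      and comp: "range \<Phi> \<subseteq> compact_operators"
      and norm: "\<And>z. norm (\<Phi> z) = minkowski_functional (B_dom p q) z"
    by blast
  interpret Vector_Spaces.linear "(*s)" scaleC_op \<Phi> by (rule lin)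
  define T where "T = \<Phi> (axis 1 1)"
  define S where "S = \<Phi> (axis 2 1)"
  \<comment> \<open>Restricting to real coefficients reduces the embedding to a statement about real
    combinations of \<open>T\<close> and \<open>S\<close>.\<close>
  have ball: "norm (a *\<^sub>R T + b *\<^sub>R S) < 1 \<longleftrightarrow> \<bar>a\<bar> powr p + \<bar>b\<bar> powr q < 1" for a b
  proof -
    define z :: "complex ^ 2"
      where "z = complex_of_real a *s axis 1 1 + complex_of_real b *s axis 2 1"
    have "\<Phi> z = a *\<^sub>R T + b *\<^sub>R S"
      unfolding z_def T_def S_def add scale scaleC_op_of_real ..
    moreover have "norm (\<Phi> z) < 1 \<longleftrightarrow> z \<in> B_dom p q"
      unfolding norm using assms by (intro minkowski_functional_less_1_iff) auto
    moreover have "z $ 1 = a" "z $ 2 = b"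
      by (simp_all add: z_def axis_def)
    ultimately show ?thesis by (simp only: B_dom_def mem_Collect_eq norm_of_real)
  qed
  \<comment> \<open>\<open>ball\<close> only detects norms strictly below 1, so \<open>T\<close> is
    approached through \<open>u *\<^sub>R T\<close> with \<open>u < 1\<close>.\<close>
  have T: "norm T \<le> 1"
  proof (rule field_le_mult_one_interval)
    fix u :: real assume u: "0 < u" "u < 1"
    then have "norm (u *\<^sub>R T + 0 *\<^sub>R S) < 1"
      unfolding ball using assms powr_less_mono'[of u 0 p] by simp
    then show "u * norm T \<le> 1" using u by simp
  qed
  have "T \<in> compact_operators"
    using comp unfolding T_def by blast
  then have compact: "compact (closure (T ` cball 0 1))"
    unfolding compact_operators_def by blast
  have flat: "\<forall>\<^sub>F s in at_right 0.
      norm ((1 - e * s\<^sup>2) *\<^sub>R T + s *\<^sub>R S) \<le> 1 \<and> norm ((1 - e * s\<^sup>2) *\<^sub>R T - s *\<^sub>R S) \<le> 1"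
    if e: "0 < e" for e
  proof -
    have "1 \<le> p" using assms by simp
    show ?thesis
      using eventually_powr_sum_less_1[OF e \<open>1 \<le> p\<close> \<open>2 < q\<close>]
    proof eventually_elim
      case (elim s)
      \<comment> \<open>The coefficient of \<open>S\<close> enters \<open>ball\<close> only through
        its absolute value, so both signs follow.\<close>
      then have "norm ((1 - e * s\<^sup>2) *\<^sub>R T + s *\<^sub>R S) < 1"
        "norm ((1 - e * s\<^sup>2) *\<^sub>R T + (- s) *\<^sub>R S) < 1"
        unfolding ball by simp_all
      then show ?case by (simp del: scaleR_left_diff_distrib)
    qed
  qed
  interpret flat_compact_perturbation T S
    by unfold_locales (fact T flat compact)+
  obtain d where d: "0 < d" "\<And>s. 0 < s \<Longrightarrow> s < d \<Longrightarrow> norm (T + s *\<^sub>R S) \<le> 1"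
    using norm_add_small_le_1 by blast
  define s where "s = d / 2"
  have s: "0 < s" "norm (T + s *\<^sub>R S) \<le> 1"
    using d by (simp_all add: s_def)
  \<comment> \<open>At \<open>u = 1\<close> the limit \<open>1 + s powr q\<close> exceeds 1, so the
    sum still does for some \<open>u < 1\<close>. By \<open>ball\<close>,
    \<open>u *\<^sub>R (T + s *\<^sub>R S)\<close> then has norm at least 1, yet its norm is at most
    \<open>u\<close>.\<close>
  have "((\<lambda>u. \<bar>u\<bar> powr p + \<bar>u * s\<bar> powr q) \<longlongrightarrow> \<bar>1\<bar> powr p + \<bar>1 * s\<bar> powr q) (at_left 1)"
    by (intro tendsto_intros) (use s in auto)
  then have "\<forall>\<^sub>F u in at_left 1. 1 < \<bar>u\<bar> powr p + \<bar>u * s\<bar> powr q"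
    by (rule order_tendstoD) (use s in simp)
  moreover have "\<forall>\<^sub>F u in at_left 1. u \<in> {0<..<(1::real)}"
    by (rule eventually_at_leftI[of 0]) auto
  ultimately have "\<forall>\<^sub>F u in at_left (1::real). False"
  proof eventually_elim
    case (elim u)
    have "u *\<^sub>R T + (u * s) *\<^sub>R S = u *\<^sub>R (T + s *\<^sub>R S)"
      by (simp add: scaleR_add_right)
    then have "norm (u *\<^sub>R T + (u * s) *\<^sub>R S) = u * norm (T + s *\<^sub>R S)"
      using elim by simp
    also have "\<dots> \<le> u * 1"
      using s elim by (intro mult_left_mono) auto
    also have "\<dots> < 1" using elim by simp
    finally show ?case using elim unfolding ball by simp
  qed
  then show False
    using eventually_happens'[OF trivial_limit_at_left_real] by blast
qed

end
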